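(* Let $L$ be a co-Heyting algebra satisfying the density axiom D1 and the splitting axiom S1. Let $L_0$ be a finite subalgebra of $L$ and let $L_1$ be a finite co-Heyting algebra containing $L_0$ as a subalgebra. Then there exists an embedding of $L_1$ into $L$ which fixes every point of $L_0$.
   Context: A co-Heyting algebra is a bounded distributive lattice $(L,\mathbf{0},\mathbf{1},\vee,\wedge)$ with a binary operation $-$ such that $a-b$ is the least $c\in L$ with $a\le b\vee c$; embeddings and subalgebras are taken in the language $\{\mathbf 0,\mathbf 1,\vee,\wedge,-\}$. For $a,b\in L$ write $b\ll a$ iff $a-b=a$ and $b\le a$. Axiom D1: for all $a,c$ with $c\ll a$ and $a\neq\mathbf 0$ there is $b\neq\mathbf 0$ with $c\ll b\ll a$. Axiom S1: for all $a,b_1,b_2$ with $b_1\vee b_2\ll a$ and $a\ne\mathbf 0$ there are non-zero $a_1,a_2$ with $a-a_2=a_1\ge b_1$, $a-a_1=a_2\ge b_2$, and $a_1\wedge a_2=b_1\wedge b_2$. *)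

theory Defs
  imports Main
begin

unbundle lattice_syntax

class coheyting_algebra = bounded_lattice + distrib_lattice + minus +
  assumes le_sup_diff: "a \<le> b \<squnion> (a - b)"
    and diff_least: "a \<le> b \<squnion> c \<Longrightarrow> a - b \<le> c"

definition strongly_below :: "'a::coheyting_algebra \<Rightarrow> 'a \<Rightarrow> bool" (infix "\<lless>" 50)
  where "b \<lless> a \<longleftrightarrow> a - b = a \<and> b \<le> a"

definition subalgebra :: "'a::coheyting_algebra set \<Rightarrow> bool"
  where "subalgebra S \<longleftrightarrow> \<bottom> \<in> S \<and> \<top> \<in> S \<and>
    (\<forall>x\<in>S. \<forall>y\<in>S. x \<squnion> y \<in> S \<and> x \<sqinter> y \<in> S \<and> x - y \<in> S)"

text \<open>
  \<open>embedding_on S f\<close> is meant for a subalgebra \<open>S\<close>, regarded as a co-Heyting algebra in its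
  own right; the values of \<open>f\<close> outside \<open>S\<close> are irrelevant.
\<close>

definition embedding_on ::
    "'a::coheyting_algebra set \<Rightarrow> ('a \<Rightarrow> 'b::coheyting_algebra) \<Rightarrow> bool"
  where "embedding_on S f \<longleftrightarrow> inj_on f S \<and> f \<bottom> = \<bottom> \<and> f \<top> = \<top> \<and>
    (\<forall>x\<in>S. \<forall>y\<in>S. f (x \<squnion> y) = f x \<squnion> f y \<and> f (x \<sqinter> y) = f x \<sqinter> f y \<and>
      f (x - y) = f x - f y)"

definition axiom_D1 :: "'a::coheyting_algebra itself \<Rightarrow> bool"
  where "axiom_D1 _ \<longleftrightarrow>
    (\<forall>a c :: 'a. c \<lless> a \<and> a \<noteq> \<bottom> \<longrightarrow> (\<exists>b. b \<noteq> \<bottom> \<and> c \<lless> b \<and> b \<lless> a))"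

definition axiom_S1 :: "'a::coheyting_algebra itself \<Rightarrow> bool"
  where "axiom_S1 _ \<longleftrightarrow>
    (\<forall>a b\<^sub>1 b\<^sub>2 :: 'a. b\<^sub>1 \<squnion> b\<^sub>2 \<lless> a \<and> a \<noteq> \<bottom> \<longrightarrow>
      (\<exists>a\<^sub>1 a\<^sub>2. a\<^sub>1 \<noteq> \<bottom> \<and> a\<^sub>2 \<noteq> \<bottom> \<and>
        a - a\<^sub>2 = a\<^sub>1 \<and> a\<^sub>1 \<ge> b\<^sub>1 \<and>
        a - a\<^sub>1 = a\<^sub>2 \<and> a\<^sub>2 \<ge> b\<^sub>2 \<and>
        a\<^sub>1 \<sqinter> a\<^sub>2 = b\<^sub>1 \<sqinter> b\<^sub>2))"

end

theory Submission imports Defs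
begin

text \<open>
  The embedding is built on growing principal ideals of the larger algebra. If \<open>f\<close> embeds the ideal
  below \<open>u\<close> and \<open>v - u = v\<close>, then \<open>f\<close> extends to the ideal below \<open>u \<squnion> v\<close> with a prescribed
  value \<open>a\<close> at \<open>v\<close>, as soon as \<open>a\<close> meets \<open>f u\<close> in \<open>f (v \<sqinter> u)\<close> and \<open>a - f u = a\<close>. To see this,
  add a minimal element \<open>q \<le> v\<close> not below \<open>u\<close>, which is join-irreducible. If \<open>v - q = v\<close>, its image
  is provided by density, after a splitting that keeps it away from \<open>f u\<close>; otherwise \<open>q\<close> is a
  component of \<open>v\<close>, and splitting \<open>a\<close> gives the images of \<open>q\<close> and of \<open>v - q\<close>. Applied along \<open>L0\<close>,
  with \<open>v\<close> a minimal element of \<open>L0\<close> not yet reached and its own value prescribed, this yields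
  the embedding over \<open>L0\<close>.
\<close>

section \<open>Arithmetic of the difference\<close>

context coheyting_algebra
begin

text \<open>Subtracting \<open>b\<close> is left adjoint to joining with \<open>b\<close>; the
  arithmetic of this section rests on that.\<close>

lemma diff_le_iff: "a - b \<le> c \<longleftrightarrow> a \<le> b \<squnion> c"
  by (meson diff_least le_sup_diff order.trans sup_mono order_refl)

lemma diff_le: "a - b \<le> a"
  by (simp add: diff_le_iff)

lemma diff_eq_bot_iff: "a - b = \<bottom> \<longleftrightarrow> a \<le> b"
  by (metis diff_le_iff bot_unique sup_bot_right)

lemma bot_diff: "\<bottom> - a = \<bottom>"
  by (simp add: diff_eq_bot_iff)

lemma diff_diff: "a - b - c = a - (b \<squnion> c)"
proof (rule order.antisym)
  show "a - b - c \<le> a - (b \<squnion> c)"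
    by (simp add: diff_le_iff le_sup_diff flip: sup_assoc)
  show "a - (b \<squnion> c) \<le> a - b - c"
    by (simp add: diff_le_iff sup_assoc) (simp add: le_sup_diff flip: diff_le_iff)
qed

lemma diff_right_commute: "a - b - c = a - c - b"
  by (simp add: diff_diff sup_commute)

lemma sup_diff: "(a \<squnion> b) - c = (a - c) \<squnion> (b - c)"
proof (rule order.antisym)
  show "(a \<squnion> b) - c \<le> (a - c) \<squnion> (b - c)"
    by (metis diff_le_iff le_supI sup_ge1 sup_ge2)
  show "(a - c) \<squnion> (b - c) \<le> (a \<squnion> b) - c"
    by (metis diff_le_iff le_sup_diff le_sup_iff)
qed

lemma diff_antimono: "b \<le> c \<Longrightarrow> a - c \<le> a - b"
  by (metis diff_diff diff_le sup_absorb2)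

lemma diff_mono: "a \<le> b \<Longrightarrow> a - c \<le> b - c"
  by (metis sup_diff sup_absorb2 sup_ge1)

text \<open>Distributivity puts \<open>a\<close> below
  \<open>(a \<sqinter> b) \<squnion> (a - b)\<close>. This later trades \<open>f u\<close> for its
  trace on an element.\<close>

lemma diff_inf: "a - (a \<sqinter> b) = a - b"
proof (rule order.antisym)
  show "a - (a \<sqinter> b) \<le> a - b"
    by (simp add: diff_le_iff sup_inf_distrib2 le_sup_diff)
qed (simp add: diff_antimono)

end

section \<open>Density and splitting\<close>

lemma splitting:
  fixes a b1 b2 :: "'a::coheyting_algebra"
  assumes "axiom_S1 TYPE('a)" "a - (b1 \<squnion> b2) = a" "b1 \<le> a" "b2 \<le> a" "a \<noteq> \<bottom>"
  obtains a1 a2 where "a1 \<noteq> \<bottom>" "a2 \<noteq> \<bottom>" "a - a2 = a1" "a - a1 = a2" "b1 \<le> a1" "b2 \<le> a2"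
    "a1 \<sqinter> a2 = b1 \<sqinter> b2" "a1 \<squnion> a2 = a"
proof -
  have "b1 \<squnion> b2 \<lless> a"
    using assms by (simp add: strongly_below_def)
  with \<open>a \<noteq> \<bottom>\<close> obtain a1 a2 where *: "a1 \<noteq> \<bottom>" "a2 \<noteq> \<bottom>" "a - a2 = a1" "a - a1 = a2" "b1 \<le> a1" "b2 \<le> a2"
    "a1 \<sqinter> a2 = b1 \<sqinter> b2"
    using assms(1)[unfolded axiom_S1_def] by metis
  have "a1 \<le> a" "a2 \<le> a"
    using *(3,4) diff_le by metis+
  moreover have "a \<le> a1 \<squnion> a2"
    using *(4) le_sup_diff by metis
  ultimately have "a1 \<squnion> a2 = a"
    by (simp add: order.antisym)
  with * show ?thesis
    by (rule that)
qed

text \<open>Density by itself says nothing about \<open>e\<close>. So \<open>a\<close> is first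
  split into parts above \<open>c\<close> and above \<open>e\<close> that meet in \<open>c\<close>,
  and density is applied inside the first part.\<close>

lemma density_disjoint:
  fixes a c e :: "'a::coheyting_algebra"
  assumes "axiom_D1 TYPE('a)" "axiom_S1 TYPE('a)"
    and "c \<le> e" "e \<le> a" "a - e = a" "a \<noteq> \<bottom>"
  shows "\<exists>b. b \<noteq> \<bottom> \<and> b - c = b \<and> b \<le> a \<and> a - b = a \<and> b \<sqinter> e = c"
proof -
  have "a - (c \<squnion> e) = a"
    using assms by (simp add: sup_absorb2)
  moreover have "c \<le> a"
    using assms(3,4) by (rule order.trans)
  ultimately obtain a1 a2 where *: "a1 \<noteq> \<bottom>" "a - a2 = a1" "a - a1 = a2" "c \<le> a1" "e \<le> a2"
    "a1 \<sqinter> a2 = c \<sqinter> e" "a1 \<squnion> a2 = a"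
    using splitting[OF assms(2) _ _ assms(4,6)] by metis
  \<comment> \<open>Since \<open>a1\<close> is \<open>a - a2\<close> and \<open>c\<close> lies below
    \<open>a2\<close>, removing \<open>c\<close> as well changes nothing.\<close>
  have "a2 \<squnion> c = a2"
    using \<open>c \<le> e\<close> *(5) by (simp add: sup_absorb1)
  then have "a1 - c = a1"
    using *(2) by (metis diff_diff)
  then have "c \<lless> a1"
    using * by (simp add: strongly_below_def)
  then obtain b where b: "b \<noteq> \<bottom>" "c \<lless> b" "b \<lless> a1"
    using assms(1) *(1) unfolding axiom_D1_def by blast
  then have b': "b - c = b" "c \<le> b" "a1 - b = a1" "b \<le> a1"
    by (auto simp: strongly_below_def)
  \<comment> \<open>The part \<open>a1\<close> survives because \<open>a1 - b = a1\<close>, the part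
    \<open>a2\<close> because it is \<open>a - a1\<close> and \<open>b \<le> a1\<close>.\<close>
  have "a1 \<le> a - b"
    using b'(3) *(7) by (metis diff_mono sup_ge1)
  moreover have "a2 \<le> a - b"
    using b'(4) *(3) by (metis diff_antimono)
  ultimately have "a \<le> a - b"
    using *(7) by (metis le_supI)
  then have "a - b = a"
    by (intro order.antisym diff_le)
  moreover have "b \<sqinter> e = c"
  proof (rule order.antisym)
    have "b \<sqinter> e \<le> a1 \<sqinter> a2"
      using b'(4) *(5) by (rule inf_mono)
    then show "b \<sqinter> e \<le> c"
      using \<open>c \<le> e\<close> *(6) by (simp add: inf_absorb1)
  qed (use b' assms in simp)
  moreover have "b \<le> a"
    using b'(4) *(7) by (metis order.trans sup_ge1)
  ultimately show ?thesis
    using b(1) b'(1) by blast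
qed

section \<open>Embeddings of principal ideals\<close>

text \<open>Injectivity is encoded as a trivial kernel, which suffices because
  \<open>x \<le> y\<close> amounts to \<open>x - y = \<bottom>\<close>. The value at
  \<open>u\<close> is left free, so that it can be prescribed.\<close>

definition embeds_below ::
    "'b::coheyting_algebra \<Rightarrow> ('b \<Rightarrow> 'a::coheyting_algebra) \<Rightarrow> bool"
  where "embeds_below u f \<longleftrightarrow> f \<bottom> = \<bottom> \<and> (\<forall>x\<le>u. f x = \<bottom> \<longrightarrow> x = \<bottom>) \<and>
    (\<forall>x\<le>u. \<forall>y\<le>u. f (x \<squnion> y) = f x \<squnion> f y \<and> f (x \<sqinter> y) = f x \<sqinter> f y \<and>
      f (x - y) = f x - f y)"

lemma embeds_belowD:
  assumes "embeds_below u f" "x \<le> u"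
  shows "f \<bottom> = \<bottom>" "f x = \<bottom> \<Longrightarrow> x = \<bottom>"
    and "y \<le> u \<Longrightarrow> f (x \<squnion> y) = f x \<squnion> f y"
    and "y \<le> u \<Longrightarrow> f (x \<sqinter> y) = f x \<sqinter> f y"
    and "y \<le> u \<Longrightarrow> f (x - y) = f x - f y"
  using assms by (auto simp: embeds_below_def)

lemma embeds_below_mono:
  assumes "embeds_below u f" "x \<le> y" "y \<le> u"
  shows "f x \<le> f y"
proof -
  have "f x = f (x \<sqinter> y)"
    using assms(2) by (simp add: inf_absorb1)
  also have "\<dots> = f x \<sqinter> f y"
    using assms by (intro embeds_belowD(4)) (auto intro: order.trans)
  finally show ?thesis
    by (metis inf.cobounded2)
qed

lemma embeds_below_top_imp_embedding_on:
  assumes "embeds_below \<top> f" "f \<top> = \<top>"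
  shows "embedding_on UNIV f"
proof -
  have le: "x \<le> y" if "f x = f y" for x y
  proof -
    have "f (x - y) = f x - f y"
      by (rule embeds_belowD(5)[OF assms(1)]) simp_all
    also have "\<dots> = \<bottom>"
      by (simp add: diff_eq_bot_iff that)
    finally have "x - y = \<bottom>"
      using embeds_belowD(2)[OF assms(1) top_greatest] by blast
    then show ?thesis
      by (simp add: diff_eq_bot_iff)
  qed
  have "inj f"
    by (intro injI order.antisym le) simp_all
  then show ?thesis
    using assms by (simp add: embedding_on_def embeds_below_def)
qed

section \<open>Extending an embedding to a larger ideal\<close>

text \<open>The meet condition on \<open>b\<close> makes the extension preserve meets,
  \<open>b - f u = b\<close> makes it preserve differences, and \<open>b \<noteq> \<bottom>\<close>
  keeps the kernel trivial.\<close>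

lemma extend_by_irreducible:
  fixes f :: "'b::coheyting_algebra \<Rightarrow> 'a::coheyting_algebra"
  assumes f: "embeds_below u f"
    and q: "\<not> q \<le> u" "\<And>x. x < q \<Longrightarrow> x \<le> u"
    and b: "b \<sqinter> f u = f (q \<sqinter> u)" "b - f u = b" "b \<noteq> \<bottom>"
  shows "\<exists>g. embeds_below (u \<squnion> q) g \<and> (\<forall>x\<le>u. g x = f x) \<and> g q = b"
proof -
  \<comment> \<open>An element below \<open>u \<squnion> q\<close> either lies below
    \<open>u\<close> or is \<open>(x \<sqinter> u) \<squnion> q\<close>; \<open>b\<close> is added
    exactly in the second case.\<close>
  define \<beta> where "\<beta> x = (if q \<le> x then b else \<bottom>)" for x
  define g where "g x = f (x \<sqinter> u) \<squnion> \<beta> x" for x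
  note f_hom = embeds_belowD(3,4,5)[OF f]
  have f_mono: "f x \<le> f y" if "x \<le> y" "y \<le> u" for x y
    using f that by (rule embeds_below_mono)
  have f_bot: "f \<bottom> = \<bottom>"
    using f by (simp add: embeds_below_def)
  have inf_q: "x \<sqinter> q \<le> u" if "\<not> q \<le> x" for x
    using q(2) that by (metis inf.absorb_iff2 inf.cobounded2 order.not_eq_order_implies_strict)
  \<comment> \<open>If \<open>q\<close> is below neither \<open>x\<close> nor \<open>y\<close>, both
    meets with \<open>q\<close> are strictly below \<open>q\<close>, hence below \<open>u\<close>,
    and so is their join.\<close>
  have q_prime: "q \<le> x \<squnion> y \<longleftrightarrow> q \<le> x \<or> q \<le> y" for x y
  proof
    assume *: "q \<le> x \<squnion> y"
    show "q \<le> x \<or> q \<le> y"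
    proof (rule ccontr)
      assume "\<not> (q \<le> x \<or> q \<le> y)"
      then have "(x \<sqinter> q) \<squnion> (y \<sqinter> q) \<le> u"
        using inf_q by simp
      then have "(x \<squnion> y) \<sqinter> q \<le> u"
        by (simp add: inf_sup_distrib2)
      then show False
        using * q(1) by (simp add: inf_absorb2)
    qed
  qed (auto intro: le_supI1 le_supI2)
  have le_u: "x \<le> u" if "x \<le> u \<squnion> q" "\<not> q \<le> x" for x
  proof -
    have "x = (x \<sqinter> u) \<squnion> (x \<sqinter> q)"
      using that by (simp add: inf_absorb1 flip: inf_sup_distrib1)
    also have "\<dots> \<le> u"
      using inf_q that by simp
    finally show ?thesis .
  qed
  have g_below: "g x = f x" if "x \<le> u" for x
  proof -
    have "\<not> q \<le> x"
      using that q(1) by (meson order.trans)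
    then show ?thesis
      using that by (simp add: g_def \<beta>_def inf_absorb1)
  qed
  have g_q: "g q = b"
    using b(1) by (metis \<beta>_def g_def inf.cobounded1 order_refl sup.absorb2)
  have g_sup: "g (x \<squnion> y) = g x \<squnion> g y" for x y
  proof -
    have "f ((x \<squnion> y) \<sqinter> u) = f (x \<sqinter> u) \<squnion> f (y \<sqinter> u)"
      by (simp add: inf_sup_distrib2 f_hom)
    moreover have "\<beta> (x \<squnion> y) = \<beta> x \<squnion> \<beta> y"
      by (simp add: \<beta>_def q_prime)
    ultimately show ?thesis
      by (simp add: g_def sup_assoc sup_left_commute)
  qed
  \<comment> \<open>The cross term of a meet is absorbed: \<open>b\<close> reaches into
    \<open>f u\<close> only as far as \<open>f (q \<sqinter> u)\<close>, and
    \<open>q \<le> x\<close>.\<close>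
  have b_inf: "b \<sqinter> f (y \<sqinter> u) \<le> f (x \<sqinter> y \<sqinter> u)" if "q \<le> x" for x y
  proof -
    have "b \<sqinter> f (y \<sqinter> u) = b \<sqinter> f u \<sqinter> f (y \<sqinter> u)"
      by (metis f_mono inf.absorb2 inf.cobounded2 inf_assoc order_refl)
    also have "\<dots> = f ((q \<sqinter> u) \<sqinter> (y \<sqinter> u))"
      by (simp add: b(1) f_hom)
    also have "\<dots> \<le> f (x \<sqinter> y \<sqinter> u)"
      using that by (intro f_mono) (auto intro: le_infI1 le_infI2)
    finally show ?thesis .
  qed
  have g_inf: "g (x \<sqinter> y) = g x \<sqinter> g y" for x y
  proof -
    have fxy: "f (x \<sqinter> y \<sqinter> u) = f (x \<sqinter> u) \<sqinter> f (y \<sqinter> u)"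
    proof -
      have "x \<sqinter> y \<sqinter> u = (x \<sqinter> u) \<sqinter> (y \<sqinter> u)"
        by (simp add: inf_aci)
      then show ?thesis
        by (simp add: f_hom)
    qed
    consider "q \<le> x" "q \<le> y" | "q \<le> x" "\<not> q \<le> y" | "\<not> q \<le> x" "q \<le> y" | "\<not> q \<le> x" "\<not> q \<le> y"
      by blast
    then show ?thesis
    proof cases
      case 1
      then show ?thesis
        by (simp add: g_def \<beta>_def fxy sup_inf_distrib2)
    next
      case 2
      then have "g x \<sqinter> g y = f (x \<sqinter> y \<sqinter> u) \<squnion> (b \<sqinter> f (y \<sqinter> u))"
        by (simp add: g_def \<beta>_def fxy inf_sup_distrib2)
      then show ?thesis
        using 2 b_inf[of x y] by (simp add: g_def \<beta>_def sup_absorb1)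
    next
      case 3
      then have "g x \<sqinter> g y = f (x \<sqinter> y \<sqinter> u) \<squnion> (f (x \<sqinter> u) \<sqinter> b)"
        by (simp add: g_def \<beta>_def fxy inf_sup_distrib1)
      moreover have "f (x \<sqinter> u) \<sqinter> b \<le> f (x \<sqinter> y \<sqinter> u)"
        using b_inf[of y x] 3 by (simp only: inf_commute[of b] inf_commute[of y x])
      ultimately show ?thesis
        using 3 by (simp add: g_def \<beta>_def sup_absorb1)
    next
      case 4
      then show ?thesis
        by (simp add: g_def \<beta>_def fxy)
    qed
  qed
  \<comment> \<open>Here \<open>y\<close> is arbitrary; replacing it by
    \<open>x \<sqinter> y\<close> moves the difference into the ideal where \<open>f\<close> is a
    homomorphism.\<close>
  have g_diff_below: "g (x - y) = g x - g y" if "x \<le> u" for x y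
  proof -
    have "x - y \<le> u"
      using diff_le that by (rule order.trans)
    then have "g (x - y) = f (x - (x \<sqinter> y))"
      by (simp add: diff_inf g_below)
    also have "\<dots> = f x - f (x \<sqinter> y)"
      using that by (simp add: f_hom le_infI1)
    also have "\<dots> = g x - g (x \<sqinter> y)"
      using that by (simp add: g_below le_infI1)
    also have "\<dots> = g x - g y"
      by (simp add: g_inf diff_inf)
    finally show ?thesis .
  qed
  \<comment> \<open>Either \<open>q \<le> y\<close> and both sides vanish, or
    \<open>y \<le> u\<close> and both subtractions change nothing.\<close>
  have g_diff_q: "g (q - y) = g q - g y" if "y \<le> u \<squnion> q" for y
  proof (cases "q \<le> y")
    case True
    then have "g q \<le> g y"
      by (metis g_inf inf.absorb_iff1)
    then have "g q - g y = \<bottom>" "q - y = \<bottom>"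
      using True by (simp_all add: diff_eq_bot_iff)
    then show ?thesis
      by (simp add: g_below f_bot)
  next
    case False
    then have "y \<le> u"
      using le_u that by blast
    have "q \<le> q - y"
      using q_prime False le_sup_diff by blast
    then have "q - y = q"
      using diff_le by (metis order.antisym)
    moreover have "b - f y = b"
      by (metis \<open>y \<le> u\<close> b(2) diff_antimono diff_le f_mono order.antisym order_refl)
    ultimately show ?thesis
      by (simp add: g_q g_below \<open>y \<le> u\<close>)
  qed
  have g_diff: "g (x - y) = g x - g y" if "x \<le> u \<squnion> q" "y \<le> u \<squnion> q" for x y
  proof (cases "q \<le> x")
    case True
    define z where "z = x \<sqinter> u"
    have "x = z \<squnion> q"
      using that(1) True unfolding z_def by (metis inf.absorb1 inf.absorb2 inf_sup_distrib1)
    moreover have "z \<le> u"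
      by (simp add: z_def)
    ultimately show ?thesis
      using that(2) by (simp add: sup_diff g_sup g_diff_below g_diff_q)
  next
    case False
    then show ?thesis
      using le_u that(1) g_diff_below by blast
  qed
  have g_inj: "x = \<bottom>" if "x \<le> u \<squnion> q" "g x = \<bottom>" for x
  proof -
    have "\<not> q \<le> x"
      using that(2) b(3) by (auto simp: g_def \<beta>_def)
    then have "x \<le> u"
      using le_u that(1) by blast
    then show ?thesis
      using f that(2) g_below by (auto simp: embeds_below_def)
  qed
  have "embeds_below (u \<squnion> q) g"
    unfolding embeds_below_def using g_sup g_inf g_diff g_inj g_below f_bot by simp
  then show ?thesis
    using g_below g_q by blast
qed

text \<open>Induction on the number of elements not below \<open>u\<close>. Each step adjoins one
  \<open>q \<le> v\<close> and restores the hypotheses over \<open>u \<squnion> q\<close>, for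
  \<open>v\<close> and \<open>a\<close> or for what remains of them.\<close>

lemma extend_by_prescribed_value:
  fixes f :: "'b::{coheyting_algebra, finite} \<Rightarrow> 'a::coheyting_algebra"
  assumes D1: "axiom_D1 TYPE('a)" and S1: "axiom_S1 TYPE('a)"
    and "embeds_below u f" "v - u = v" "v \<noteq> \<bottom>"
    and "a \<noteq> \<bottom>" "a - f u = a" "a \<sqinter> f u = f (v \<sqinter> u)"
  shows "\<exists>g. embeds_below (u \<squnion> v) g \<and> (\<forall>x\<le>u. g x = f x) \<and> g v = a"
  using assms(3-)
proof (induction "card {x. \<not> x \<le> u}" arbitrary: u v f a rule: less_induct)
  case less
  note f = \<open>embeds_below u f\<close> and vu = \<open>v - u = v\<close> and au = \<open>a - f u = a\<close>
    and a_inf = \<open>a \<sqinter> f u = f (v \<sqinter> u)\<close>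
  have "\<not> v \<le> u"
    using vu \<open>v \<noteq> \<bottom>\<close> diff_eq_bot_iff[of v u] by argo
  then have "{x. x \<le> v \<and> \<not> x \<le> u} \<noteq> {}"
    by blast
  from finite_has_minimal[OF finite this]
  obtain q where q: "q \<le> v" "\<not> q \<le> u"
    and q_min: "\<And>x. \<lbrakk>x \<le> v; \<not> x \<le> u; x \<le> q\<rbrakk> \<Longrightarrow> q = x"
    by blast
  have below_q: "x \<le> u" if "x < q" for x
  proof (rule ccontr)
    assume "\<not> x \<le> u"
    moreover have "x \<le> q" "x \<le> v"
      using that q(1) by (auto intro: order.trans)
    ultimately have "q = x"
      using q_min by blast
    then show False
      using that by simp
  qed
  have smaller: "card {x. \<not> x \<le> u \<squnion> q} < card {x. \<not> x \<le> u}"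
  proof (rule psubset_card_mono)
    have "q \<in> {x. \<not> x \<le> u}" "q \<notin> {x. \<not> x \<le> u \<squnion> q}"
      using q by simp_all
    moreover have "{x. \<not> x \<le> u \<squnion> q} \<subseteq> {x. \<not> x \<le> u}"
      using le_supI1 by (intro Collect_mono) blast
    ultimately show "{x. \<not> x \<le> u \<squnion> q} \<subset> {x. \<not> x \<le> u}"
      by blast
  qed simp
  consider "q = v" | "q \<noteq> v" "v - q = v" | "q \<noteq> v" "v - q \<noteq> v"
    by blast
  then show ?case
  proof cases
    case 1
    have q_inf: "a \<sqinter> f u = f (q \<sqinter> u)"
      using a_inf 1 by simp
    from extend_by_irreducible[OF f q(2) below_q q_inf au \<open>a \<noteq> \<bottom>\<close>]
    obtain g where "embeds_below (u \<squnion> q) g" "\<And>x. x \<le> u \<Longrightarrow> g x = f x" "g q = a"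
      by blast
    then show ?thesis
      using 1 by blast
  next
    case 2
    have "q \<sqinter> u \<le> v \<sqinter> u"
      using q(1) order_refl by (rule inf_mono)
    then have le: "f (q \<sqinter> u) \<le> f (v \<sqinter> u)"
      by (intro embeds_below_mono[OF f]) simp_all
    have "f (v \<sqinter> u) \<le> a"
      by (simp flip: a_inf)
    moreover have "a - f (v \<sqinter> u) = a"
      using au by (simp add: diff_inf flip: a_inf)
    ultimately obtain b where b: "b \<noteq> \<bottom>" "b - f (q \<sqinter> u) = b" "b \<le> a" "a - b = a"
      "b \<sqinter> f (v \<sqinter> u) = f (q \<sqinter> u)"
      using density_disjoint[OF D1 S1 le _ _ \<open>a \<noteq> \<bottom>\<close>] by blast
    \<comment> \<open>Inside \<open>a\<close>, the trace of \<open>f u\<close> is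
      \<open>f (v \<sqinter> u)\<close>, so the control of \<open>b\<close> over that trace extends
      to \<open>f u\<close>.\<close>
    have b_inf: "b \<sqinter> f u = f (q \<sqinter> u)"
      using b(3,5) a_inf by (metis inf.absorb1 inf_assoc)
    then have b_diff: "b - f u = b"
      using b(2) by (metis diff_inf)
    from extend_by_irreducible[OF f q(2) below_q b_inf b_diff b(1)]
    obtain g where g: "embeds_below (u \<squnion> q) g" "\<And>x. x \<le> u \<Longrightarrow> g x = f x" "g q = b"
      by blast
    have g_u: "g (u \<squnion> q) = f u \<squnion> b"
      using g by (simp add: embeds_belowD(3)[OF g(1)])
    \<comment> \<open>The same \<open>v\<close> and \<open>a\<close> serve in the recursion, as
      \<open>v - q = v\<close> and \<open>a - b = a\<close>.\<close>
    have v_diff: "v - (u \<squnion> q) = v"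
      using vu 2 by (simp flip: diff_diff)
    have a_diff: "a - g (u \<squnion> q) = a"
      using au b by (simp add: g_u flip: diff_diff)
    have a_inf': "a \<sqinter> g (u \<squnion> q) = g (v \<sqinter> (u \<squnion> q))"
    proof -
      have "g (v \<sqinter> (u \<squnion> q)) = g ((v \<sqinter> u) \<squnion> q)"
        using q by (simp add: inf_sup_distrib1 inf_absorb2)
      also have "\<dots> = f (v \<sqinter> u) \<squnion> b"
        using g by (simp add: embeds_belowD(3)[OF g(1)] le_infI2 le_supI1)
      finally show ?thesis
        using b(3) a_inf by (simp add: g_u inf_sup_distrib1 inf_absorb2)
    qed
    from less.hyps[OF smaller g(1) v_diff \<open>v \<noteq> \<bottom>\<close> \<open>a \<noteq> \<bottom>\<close> a_diff a_inf']
    obtain h where "embeds_below (u \<squnion> q \<squnion> v) h" "\<forall>x\<le>u \<squnion> q. h x = g x" "h v = a"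
      by blast
    moreover have "u \<squnion> q \<squnion> v = u \<squnion> v"
      using q by (simp add: sup_assoc sup_absorb2)
    ultimately show ?thesis
      using g(2) by (metis le_supI1)
  next
    case 3
    define w where "w = v - q"
    have v_eq: "q \<squnion> w = v"
      unfolding w_def using q by (metis diff_le le_sup_diff le_supI order.antisym)
    have "\<not> q \<le> w"
      using 3 v_eq w_def by (metis sup_absorb2)
    \<comment> \<open>The meet is strictly below \<open>q\<close>, so the components
      \<open>q\<close> and \<open>w\<close> of \<open>v\<close> overlap only inside
      \<open>u\<close>.\<close>
    then have qw: "q \<sqinter> w \<le> u"
      using below_q by (metis inf.absorb_iff1 inf.cobounded1 order.not_eq_order_implies_strict)
    have "w \<noteq> \<bottom>"
      using v_eq 3 by auto
    \<comment> \<open>These are the traces on \<open>f u\<close> that the images of \<open>q\<close>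
      and \<open>w\<close> must have; together they make up the trace of \<open>a\<close>.\<close>
    define b1 b2 where "b1 = f (q \<sqinter> u)" and "b2 = f (w \<sqinter> u)"
    have b12: "b1 \<squnion> b2 = a \<sqinter> f u"
      unfolding b1_def b2_def a_inf
      by (simp add: inf_sup_distrib2 embeds_belowD(3)[OF f] flip: v_eq)
    then have "a - (b1 \<squnion> b2) = a"
      using au by (simp add: diff_inf)
    moreover have "b1 \<le> a" "b2 \<le> a"
      using b12 by (metis inf.cobounded1 le_sup_iff)+
    ultimately obtain a1 a2 where a: "a1 \<noteq> \<bottom>" "a2 \<noteq> \<bottom>" "a - a2 = a1" "a - a1 = a2"
      "b1 \<le> a1" "b2 \<le> a2" "a1 \<sqinter> a2 = b1 \<sqinter> b2" "a1 \<squnion> a2 = a"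
      using splitting[OF S1] \<open>a \<noteq> \<bottom>\<close> by metis
    \<comment> \<open>No trace leaks into the other half: \<open>a1 \<sqinter> b2\<close> lies below
      \<open>a1 \<sqinter> a2 = b1 \<sqinter> b2\<close>. The same holds for
      \<open>a2\<close>.\<close>
    have a1_inf: "a1 \<sqinter> f u = b1"
    proof -
      have "a1 \<sqinter> f u = a1 \<sqinter> (b1 \<squnion> b2)"
        unfolding b12 using a(8) by (metis inf_assoc inf_sup_absorb)
      also have "\<dots> = b1 \<squnion> (a1 \<sqinter> b2)"
        using a(5) by (simp add: inf_sup_distrib1 inf_absorb2)
      also have "\<dots> = b1"
        using a(6,7) by (metis inf.boundedE inf_mono order_refl sup_absorb1)
      finally show ?thesis .
    qed
    have a2_inf: "a2 \<sqinter> f u = b2"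
    proof -
      have "a2 \<sqinter> f u = a2 \<sqinter> (b1 \<squnion> b2)"
        unfolding b12 using a(8) by (metis inf_assoc inf_sup_absorb sup_commute)
      also have "\<dots> = (a2 \<sqinter> b1) \<squnion> b2"
        using a(6) by (simp add: inf_sup_distrib1 inf_absorb2)
      also have "\<dots> = b2"
        using a(5,7) by (metis inf.boundedE inf_commute inf_mono order_refl sup_absorb2)
      finally show ?thesis .
    qed
    have a1_diff: "a1 - f u = a1"
      using au a(3) by (metis diff_right_commute)
    from extend_by_irreducible[OF f q(2) below_q a1_inf[unfolded b1_def] a1_diff a(1)]
    obtain g where g: "embeds_below (u \<squnion> q) g" "\<And>x. x \<le> u \<Longrightarrow> g x = f x" "g q = a1"
      by blast
    have g_u: "g (u \<squnion> q) = f u \<squnion> a1"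
      using g by (simp add: embeds_belowD(3)[OF g(1)])
    \<comment> \<open>As \<open>w\<close> is \<open>v - q\<close> and \<open>v - u = v\<close>, both
      subtractions have already been made; likewise for \<open>a2\<close>, which is
      \<open>a - a1\<close>.\<close>
    have w_diff: "w - (u \<squnion> q) = w"
      using vu unfolding w_def by (metis diff_diff sup_commute sup.idem sup_assoc)
    have a2_diff: "a2 - g (u \<squnion> q) = a2"
      using au a(4) unfolding g_u by (metis diff_diff sup_commute sup.idem sup_assoc)
    have a2_inf': "a2 \<sqinter> g (u \<squnion> q) = g (w \<sqinter> (u \<squnion> q))"
    proof -
      have "w \<sqinter> (u \<squnion> q) = w \<sqinter> u"
        using qw by (simp add: inf_sup_distrib1 inf_commute sup_absorb1)
      then have "g (w \<sqinter> (u \<squnion> q)) = b2"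
        using g(2) b2_def by simp
      moreover have "a2 \<sqinter> g (u \<squnion> q) = b2 \<squnion> (b1 \<sqinter> b2)"
        using a2_inf a(7) by (simp add: g_u inf_sup_distrib1 inf_commute)
      ultimately show ?thesis
        by (simp add: sup_absorb1)
    qed
    from less.hyps[OF smaller g(1) w_diff \<open>w \<noteq> \<bottom>\<close> a(2) a2_diff a2_inf']
    obtain h where h: "embeds_below (u \<squnion> q \<squnion> w) h" "\<forall>x\<le>u \<squnion> q. h x = g x" "h w = a2"
      by blast
    have "u \<squnion> q \<squnion> w = u \<squnion> v"
      using v_eq by (simp add: sup_assoc)
    moreover have "h v = a"
    proof -
      have "h (q \<squnion> w) = h q \<squnion> h w"
        by (rule embeds_belowD(3)[OF h(1)]) (auto intro: le_supI1)
      then show ?thesis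
        using v_eq h g(3) a(8) by simp
    qed
    ultimately show ?thesis
      using h g(2) by (metis le_supI1)
  qed
qed

section \<open>Embedding over a finite subalgebra\<close>

text \<open>The larger algebra is the finite type \<open>'b\<close>, and the inclusion of
  \<open>L0\<close> into it is rendered by \<open>\<iota>\<close>; fixing \<open>L0\<close>
  pointwise means that \<open>f\<close> inverts \<open>\<iota>\<close> there.\<close>

theorem theorem4p4:
  fixes L0 :: "'a::coheyting_algebra set"
    and \<iota> :: "'a \<Rightarrow> 'b::{coheyting_algebra, finite}"
  assumes "axiom_D1 TYPE('a)" and "axiom_S1 TYPE('a)"
    and "subalgebra L0" and "finite L0"
    and "embedding_on L0 \<iota>"
  shows "\<exists>f :: 'b \<Rightarrow> 'a. embedding_on UNIV f \<and> (\<forall>x\<in>L0. f (\<iota> x) = x)"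
proof -
  have L0: "\<bottom> \<in> L0" "\<top> \<in> L0"
    and L0_closed: "\<And>x y. x \<in> L0 \<Longrightarrow> y \<in> L0 \<Longrightarrow> x \<squnion> y \<in> L0 \<and> x \<sqinter> y \<in> L0 \<and> x - y \<in> L0"
    using \<open>subalgebra L0\<close> by (auto simp: subalgebra_def)
  have \<iota>: "inj_on \<iota> L0" "\<iota> \<bottom> = \<bottom>" "\<iota> \<top> = \<top>"
    and \<iota>_hom: "\<And>x y. x \<in> L0 \<Longrightarrow> y \<in> L0 \<Longrightarrow>
      \<iota> (x \<squnion> y) = \<iota> x \<squnion> \<iota> y \<and> \<iota> (x \<sqinter> y) = \<iota> x \<sqinter> \<iota> y \<and> \<iota> (x - y) = \<iota> x - \<iota> y"
    using \<open>embedding_on L0 \<iota>\<close> by (auto simp: embedding_on_def)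
  have \<iota>_mono: "\<iota> x \<le> \<iota> y" if "x \<in> L0" "y \<in> L0" "x \<le> y" for x y
    using that \<iota>_hom by (metis inf.absorb_iff1)
  \<comment> \<open>The climb along \<open>L0\<close> is replaced by a maximal \<open>A\<close> up
    to which an embedding exists; it starts from the constant map on the one-point ideal below
    \<open>\<bottom>\<close>.\<close>
  define good where "good A \<longleftrightarrow> A \<in> L0 \<and>
    (\<exists>f :: 'b \<Rightarrow> 'a. embeds_below (\<iota> A) f \<and> (\<forall>x\<in>L0. x \<le> A \<longrightarrow> f (\<iota> x) = x))" for A
  have "embeds_below \<bottom> (\<lambda>_ :: 'b. \<bottom> :: 'a)"
    by (auto simp: embeds_below_def bot_diff bot_unique)
  then have "good \<bottom>"
    unfolding good_def using L0 \<iota> by (auto simp: bot_unique)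
  moreover have "finite {A. good A}"
    using \<open>finite L0\<close> by (rule finite_subset[rotated]) (auto simp: good_def)
  ultimately obtain A where A: "good A" and A_max: "\<And>B. good B \<Longrightarrow> A \<le> B \<Longrightarrow> B = A"
    using finite_has_maximal[of "{A. good A}"] by (metis empty_iff mem_Collect_eq)
  then obtain f :: "'b \<Rightarrow> 'a" where f: "embeds_below (\<iota> A) f"
    and f_\<iota>: "\<And>x. x \<in> L0 \<Longrightarrow> x \<le> A \<Longrightarrow> f (\<iota> x) = x" and "A \<in> L0"
    by (auto simp: good_def)
  have "A = \<top>"
  proof (rule ccontr)
    assume "A \<noteq> \<top>"
    then have "\<not> \<top> \<le> A"
      by (simp add: top_unique)
    then obtain a where a: "a \<in> L0" "\<not> a \<le> A"
      and a_min: "\<And>x. x \<in> L0 \<Longrightarrow> \<not> x \<le> A \<Longrightarrow> x \<le> a \<Longrightarrow> x = a"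
      using finite_has_minimal[of "{x \<in> L0. \<not> x \<le> A}"] \<open>finite L0\<close> L0(2) by auto
    \<comment> \<open>The difference \<open>a - A\<close> is again in \<open>L0\<close>, below
      \<open>a\<close> and not below \<open>A\<close>, so minimality makes it equal to
      \<open>a\<close>.\<close>
    have "\<not> a - A \<le> A"
      using a(2) by (simp add: diff_le_iff)
    then have aA: "a - A = a"
      using a_min a(1) \<open>A \<in> L0\<close> L0_closed diff_le by blast
    have "a \<noteq> \<bottom>"
      using a(2) by auto
    then have "\<iota> a \<noteq> \<bottom>"
      using \<iota> a(1) L0(1) by (metis inj_onD)
    moreover have "\<iota> a - \<iota> A = \<iota> a"
      using \<iota>_hom[OF a(1) \<open>A \<in> L0\<close>] aA by simp
    moreover have "a - f (\<iota> A) = a"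
      using f_\<iota> \<open>A \<in> L0\<close> aA by simp
    moreover have "a \<sqinter> f (\<iota> A) = f (\<iota> a \<sqinter> \<iota> A)"
    proof -
      have "f (\<iota> (a \<sqinter> A)) = a \<sqinter> A"
        using f_\<iota> L0_closed a(1) \<open>A \<in> L0\<close> by simp
      then show ?thesis
        using f_\<iota> \<iota>_hom a(1) \<open>A \<in> L0\<close> by simp
    qed
    \<comment> \<open>In \<open>'b\<close> there may be further elements below
      \<open>\<iota> a\<close> and not below \<open>\<iota> A\<close>, hence the general extension,
      with \<open>a\<close> itself as the prescribed value.\<close>
    ultimately have "\<exists>g. embeds_below (\<iota> A \<squnion> \<iota> a) g \<and> (\<forall>x\<le>\<iota> A. g x = f x) \<and> g (\<iota> a) = a"
      using \<open>a \<noteq> \<bottom>\<close> by (intro extend_by_prescribed_value[OF assms(1,2) f])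
    then obtain g where g: "embeds_below (\<iota> A \<squnion> \<iota> a) g" "\<forall>x\<le>\<iota> A. g x = f x" "g (\<iota> a) = a"
      by blast
    have below: "g (\<iota> x) = x" if "x \<in> L0" "x \<le> A" for x
      using that g(2) f_\<iota> \<iota>_mono \<open>A \<in> L0\<close> by simp
    have "g (\<iota> x) = x" if x: "x \<in> L0" "x \<le> A \<squnion> a" for x
    proof -
      have in_L0: "x \<sqinter> A \<in> L0" "x \<sqinter> a \<in> L0"
        using x(1) a(1) \<open>A \<in> L0\<close> L0_closed by auto
      have x_eq: "x = (x \<sqinter> A) \<squnion> (x \<sqinter> a)"
        using x(2) by (simp add: inf_absorb1 flip: inf_sup_distrib1)
      \<comment> \<open>By minimality \<open>x \<sqinter> a\<close> is either \<open>a\<close> or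
        below \<open>A\<close>, and both values are known.\<close>
      have "g (\<iota> (x \<sqinter> a)) = x \<sqinter> a"
        using below g(3) a_min in_L0(2) by (metis inf.cobounded2)
      moreover have "g (\<iota> (x \<sqinter> A)) = x \<sqinter> A"
        using below in_L0(1) by simp
      moreover have "g (\<iota> (x \<sqinter> A) \<squnion> \<iota> (x \<sqinter> a)) = g (\<iota> (x \<sqinter> A)) \<squnion> g (\<iota> (x \<sqinter> a))"
        using \<iota>_mono in_L0 a(1) \<open>A \<in> L0\<close>
        by (intro embeds_belowD(3)[OF g(1)]) (auto intro: le_supI1 le_supI2)
      ultimately show ?thesis
        using x_eq \<iota>_hom in_L0 by metis
    qed
    moreover have "embeds_below (\<iota> (A \<squnion> a)) g"
      using g(1) \<iota>_hom a(1) \<open>A \<in> L0\<close> by simp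
    ultimately have "good (A \<squnion> a)"
      unfolding good_def using L0_closed a(1) \<open>A \<in> L0\<close> by blast
    then have "A \<squnion> a = A"
      using A_max by simp
    then show False
      using a(2) by (metis sup_ge2)
  qed
  have "embedding_on UNIV f"
  proof (rule embeds_below_top_imp_embedding_on)
    show "embeds_below \<top> f"
      using f \<iota>(3) \<open>A = \<top>\<close> by simp
    \<comment> \<open>The top is reached because it belongs to \<open>L0\<close> and is therefore
      fixed.\<close>
    show "f \<top> = \<top>"
      using f_\<iota>[OF L0(2)] \<iota>(3) \<open>A = \<top>\<close> by simp
  qed
  moreover have "\<forall>x\<in>L0. f (\<iota> x) = x"
    using f_\<iota> \<open>A = \<top>\<close> by simp
  ultimately show ?thesis
    by blast
qed

end
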